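(* Let $\kappa\in\mathbb{R}$ and let $X,X'$ be compact spaces with curvature $\leq\kappa$. For any $\xi\in\left(0,\tfrac1{14}\right]$, let $\beta$ be a number satisfying $0<\beta<\frac{1}{1+2\xi}\min\{\Delta(X),\Delta(X')\}$. If $X$ and $X'$ are $(\xi\beta,\beta)$-Gromov–Hausdorff close, then $X$ and $X'$ are homotopy equivalent. In particular, $$d_{GH}(X,X')<\xi\beta\quad\Longrightarrow\quad X\simeq X'.$$
   Context: **Complete length spaces.** For a metric space $(X,d)$ the length of a continuous path $\gamma:[a,b]\to X$ is $L(\gamma)=\sup\sum_i d(\gamma(t_i),\gamma(t_{i+1}))$ over all partitions. $(X,d)$ is a length space if $d(x_1,x_2)$ is the infimum of lengths of paths joining $x_1,x_2$ for all $x_1,x_2$; it is a complete length space (geodesic space) if moreover any two points are joined by a shortest path, i.e. a path of length $d(x_1,x_2)$. **Convexity radius.** A subset $A$ of a length space is convex if any two points of $A$ are joined by a unique shortest path and this path lies in $A$. The convexity radius is $\rho(X)=\inf_{x\in X}\sup\{r\ge 0\mid \mathbb{B}_X(x,s)\text{ is convex for all }0<s<r\}$, where $\mathbb{B}_X(x,s)$ is the open metric ball. **Curvature $\leq\kappa$.** A complete length space $(X,d)$ has curvature $\leq\kappa$ if for any $x_1,x_2,x_3$ in a convex ball of $X$ (and, if $\kappa>0$, with $d(x_1,x_2)+d(x_2,x_3)+d(x_3,x_1)<2\pi/\sqrt{\kappa}$) and any $y$ on a shortest path joining $x_1$ and $x_3$, we have $d(y,x_2)\le d(\overline y,\overline x_2)$,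 where $\overline x_1,\overline x_2,\overline x_3$ are points of the model surface of constant curvature $\kappa$ with $d(\overline x_i,\overline x_j)=d(x_i,x_j)$ and $\overline y$ is the point on the shortest path joining $\overline x_1$ and $\overline x_3$ with $d(\overline x_1,\overline y)=d(x_1,y)$. **$\Delta(X)$.** $\Delta(X)=\min\{\frac{\pi}{4\sqrt{\kappa}},\rho(X)\}$ if $\kappa>0$, and $\Delta(X)=\rho(X)$ if $\kappa\le0$. **Gromov–Hausdorff notions.** A correspondence between $X$ and $Y$ is a subset $\mathscr{C}\subset X\times Y$ projecting onto both factors. $d_{GH}(X,Y)=\frac12\inf_{\mathscr{C}}\sup_{(x_1,y_1),(x_2,y_2)\in\mathscr{C}}|d_X(x_1,x_2)-d_Y(y_1,y_2)|$ over all correspondences. For $\varepsilon,R>0$, $X$ and $Y$ are $(\varepsilon,R)$-Gromov–Hausdorff close if there is a correspondence $\mathscr{C}\subset X\times Y$ such that for any $(x_1,y_1),(x_2,y_2)\in\mathscr{C}$ with $\min\{d_X(x_1,x_2),d_Y(y_1,y_2)\}\le R$ we have $|d_X(x_1,x_2)-d_Y(y_1,y_2)|\le2\varepsilon$. *)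

theory Defs
  imports "HOL-Analysis.Analysis"
begin

subsection \<open>Lengths, shortest paths, length spaces\<close>

definition joins :: "'a metric \<Rightarrow> 'a \<Rightarrow> 'a \<Rightarrow> real \<Rightarrow> real \<Rightarrow> (real \<Rightarrow> 'a) \<Rightarrow> bool" where
  "joins X x y a b \<gamma> \<longleftrightarrow>
     a \<le> b \<and> continuous_map (top_of_set {a..b}) (mtopology_of X) \<gamma> \<and> \<gamma> a = x \<and> \<gamma> b = y"

definition curve_length :: "'a metric \<Rightarrow> real \<Rightarrow> real \<Rightarrow> (real \<Rightarrow> 'a) \<Rightarrow> ennreal" where
  "curve_length X a b \<gamma> =
     Sup {ennreal (\<Sum>i<n. mdist X (\<gamma> (t i)) (\<gamma> (t (Suc i)))) | n t.
            t 0 = a \<and> t n = b \<and> (\<forall>i<n. t i \<le> t (Suc i))}"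

definition shortest_path :: "'a metric \<Rightarrow> 'a \<Rightarrow> 'a \<Rightarrow> real \<Rightarrow> real \<Rightarrow> (real \<Rightarrow> 'a) \<Rightarrow> bool" where
  "shortest_path X x y a b \<gamma> \<longleftrightarrow>
     joins X x y a b \<gamma> \<and> curve_length X a b \<gamma> = ennreal (mdist X x y)"

definition length_space :: "'a metric \<Rightarrow> bool" where
  "length_space X \<longleftrightarrow>
     (\<forall>x\<in>mspace X. \<forall>y\<in>mspace X.
        ennreal (mdist X x y) = Inf {curve_length X a b \<gamma> | a b \<gamma>. joins X x y a b \<gamma>})"

text \<open>``Complete'' refers to the existence of shortest paths, not to convergence of Cauchy
  sequences.\<close>

definition complete_length_space :: "'a metric \<Rightarrow> bool" where
  "complete_length_space X \<longleftrightarrow> length_space X \<and>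
     (\<forall>x\<in>mspace X. \<forall>y\<in>mspace X. \<exists>a b \<gamma>. shortest_path X x y a b \<gamma>)"

subsection \<open>Convexity\<close>

text \<open>Uniqueness of a shortest path is meant up to reparametrization.  Along a shortest path
  \<open>\<gamma>\<close> from \<open>x\<close> the function \<open>t \<mapsto> d(x, \<gamma>(t))\<close> is continuous and monotone and determines
  \<open>\<gamma>(t)\<close>, so two shortest paths from \<open>x\<close> to \<open>y\<close> agree up to reparametrization exactly if they
  have the same trace.\<close>

definition shortest_traces :: "'a metric \<Rightarrow> 'a \<Rightarrow> 'a \<Rightarrow> 'a set set" where
  "shortest_traces X x y = {\<gamma> ` {a..b} | a b \<gamma>. shortest_path X x y a b \<gamma>}"

definition length_convex :: "'a metric \<Rightarrow> 'a set \<Rightarrow> bool" where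
  "length_convex X A \<longleftrightarrow> A \<subseteq> mspace X \<and>
     (\<forall>x\<in>A. \<forall>y\<in>A. \<exists>C. shortest_traces X x y = {C} \<and> C \<subseteq> A)"

definition convexity_radius :: "'a metric \<Rightarrow> ennreal" where
  "convexity_radius X =
     (INF x\<in>mspace X.
        SUP r\<in>{r::real. 0 \<le> r \<and> (\<forall>s. 0 < s \<and> s < r \<longrightarrow> length_convex X (mball_of X x s))}.
          ennreal r)"

subsection \<open>The model surfaces\<close>

text \<open>The surfaces are realised in \<open>\<real>\<^sup>2 \<times> \<real>\<close>: for \<open>\<kappa> > 0\<close> the unit sphere with the angular
  metric scaled by \<open>1/\<surd>\<kappa>\<close>; for \<open>\<kappa> = 0\<close> the Euclidean plane; for \<open>\<kappa> < 0\<close> the upper sheet of the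
  hyperboloid \<open>|u|\<^sup>2 - t\<^sup>2 = -1\<close> with the hyperbolic metric scaled by \<open>1/\<surd>(-\<kappa>)\<close>.\<close>

definition lorentz :: "(real^2) \<times> real \<Rightarrow> (real^2) \<times> real \<Rightarrow> real" where
  "lorentz p q = snd p * snd q - fst p \<bullet> fst q"

definition model_carrier :: "real \<Rightarrow> ((real^2) \<times> real) set" where
  "model_carrier \<kappa> =
     (if \<kappa> > 0 then {p. norm p = 1}
      else if \<kappa> = 0 then {p. snd p = 0}
      else {p. lorentz p p = 1 \<and> snd p > 0})"

definition model_dist :: "real \<Rightarrow> (real^2) \<times> real \<Rightarrow> (real^2) \<times> real \<Rightarrow> real" where
  "model_dist \<kappa> p q =
     (if p \<in> model_carrier \<kappa> \<and> q \<in> model_carrier \<kappa> then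
        (if \<kappa> > 0 then arccos (p \<bullet> q) / sqrt \<kappa>
         else if \<kappa> = 0 then dist p q
         else arcosh (lorentz p q) / sqrt (- \<kappa>))
      else 0)"

definition model_surface :: "real \<Rightarrow> ((real^2) \<times> real) metric" where
  "model_surface \<kappa> = metric (model_carrier \<kappa>, model_dist \<kappa>)"

lemma inner_unit_bounds:
  fixes p q :: "'a::real_inner"
  assumes "norm p = 1" "norm q = 1"
  shows "- 1 \<le> p \<bullet> q" "p \<bullet> q \<le> 1"
  using Cauchy_Schwarz_ineq2[of p q] assms by auto

lemma arccos_inner_triangle:
  fixes p q r :: "'a::real_inner"
  assumes "norm p = 1" "norm q = 1" "norm r = 1"
  shows "arccos (p \<bullet> r) \<le> arccos (p \<bullet> q) + arccos (q \<bullet> r)"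
proof -
  define a b where "a = p \<bullet> q" and "b = q \<bullet> r"
  have ab: "-1 \<le> a" "a \<le> 1" "-1 \<le> b" "b \<le> 1" and c: "-1 \<le> p \<bullet> r" "p \<bullet> r \<le> 1"
    using inner_unit_bounds assms by (auto simp: a_def b_def)
  show ?thesis
  proof (cases "arccos a + arccos b \<le> pi")
    case False
    then show ?thesis
      using arccos_ubound[OF c] by (simp add: a_def b_def)
  next
    case True
    have 1: "p \<bullet> p = 1" "q \<bullet> q = 1" "r \<bullet> r = 1"
      using assms by (simp_all add: dot_square_norm)
    have n1: "norm (p - a *\<^sub>R q) = sqrt (1 - a\<^sup>2)"
      unfolding norm_eq_sqrt_inner
      by (simp add: inner_diff_left inner_diff_right 1 a_def inner_commute power2_eq_square)
    have n2: "norm (r - b *\<^sub>R q) = sqrt (1 - b\<^sup>2)"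
      unfolding norm_eq_sqrt_inner
      by (simp add: inner_diff_left inner_diff_right 1 b_def inner_commute power2_eq_square)
    have "(p - a *\<^sub>R q) \<bullet> (r - b *\<^sub>R q) = p \<bullet> r - a * b"
      by (simp add: inner_diff_left inner_diff_right 1 a_def b_def inner_commute)
    then have "a * b - sqrt (1 - a\<^sup>2) * sqrt (1 - b\<^sup>2) \<le> p \<bullet> r"
      using Cauchy_Schwarz_ineq2[of "p - a *\<^sub>R q" "r - b *\<^sub>R q"] n1 n2 by auto
    then have le: "cos (arccos a + arccos b) \<le> p \<bullet> r"
      using ab by (simp add: cos_add sin_arccos_abs)
    have "0 \<le> arccos a + arccos b"
      using ab by (simp add: arccos_lbound)
    then have "arccos (cos (arccos a + arccos b)) = arccos a + arccos b"
      using True by (simp add: arccos_cos)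
    then show ?thesis
      using arccos_le_arccos[OF _ le] c by (simp add: a_def b_def)
  qed
qed

lemma arccos_inner_eq_0:
  fixes p q :: "'a::real_inner"
  assumes "norm p = 1" "norm q = 1"
  shows "arccos (p \<bullet> q) = 0 \<longleftrightarrow> p = q"
proof
  assume "arccos (p \<bullet> q) = 0"
  then have "p \<bullet> q = 1"
    using cos_arccos[OF inner_unit_bounds[OF assms]] by simp
  moreover have "(p - q) \<bullet> (p - q) = p \<bullet> p - 2 * (p \<bullet> q) + q \<bullet> q"
    by (simp add: inner_diff_left inner_diff_right inner_commute)
  ultimately have "(p - q) \<bullet> (p - q) = 0"
    by (simp only: dot_square_norm assms) simp
  then show "p = q" by simp
qed (use assms in \<open>simp add: dot_square_norm\<close>)

lemma lorentz_commute: "lorentz p q = lorentz q p"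
  by (simp add: lorentz_def inner_commute)

lemma lorentz_orthogonal_spacelike:
  assumes "lorentz q q = 1" "lorentz v q = 0" "v \<noteq> 0"
  shows "lorentz v v < 0"
proof -
  obtain u t where v: "v = (u, t)" by force
  obtain w s where q: "q = (w, s)" by force
  have s2: "s\<^sup>2 = 1 + w \<bullet> w" and ts: "t * s = u \<bullet> w"
    using assms by (auto simp: lorentz_def v q power2_eq_square)
  have pos: "s\<^sup>2 > 0" using s2 by (simp add: add_pos_nonneg)
  have "u \<noteq> 0"
  proof
    assume "u = 0"
    then have "t = 0" using ts pos by auto
    then show False using \<open>u = 0\<close> assms(3) by (simp add: v zero_prod_def)
  qed
  have "t\<^sup>2 * s\<^sup>2 = (u \<bullet> w)\<^sup>2" using ts by (metis power_mult_distrib)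
  also have "\<dots> \<le> (u \<bullet> u) * (w \<bullet> w)" by (rule Cauchy_Schwarz_ineq)
  also have "\<dots> < (u \<bullet> u) * s\<^sup>2" using \<open>u \<noteq> 0\<close> by (simp add: s2)
  finally have "t\<^sup>2 < u \<bullet> u" using pos by (simp add: mult_less_cancel_right)
  then show ?thesis by (simp add: lorentz_def v power2_eq_square)
qed

lemma lorentz_linear:
  "lorentz (p - q) r = lorentz p r - lorentz q r"
  "lorentz r (p - q) = lorentz r p - lorentz r q"
  "lorentz (c *\<^sub>R p) r = c * lorentz p r"
  "lorentz r (c *\<^sub>R p) = c * lorentz r p"
  by (simp_all add: lorentz_def inner_diff_left inner_diff_right algebra_simps)

lemma lorentz_Cauchy_Schwarz:
  assumes q: "lorentz q q = 1" and v: "lorentz v q = 0" and w: "lorentz w q = 0"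
  shows "(lorentz v w)\<^sup>2 \<le> lorentz v v * lorentz w w"
proof (cases "w = 0")
  case True
  then show ?thesis by (simp add: lorentz_def)
next
  case False
  define g h k where "g = lorentz v v" and "h = lorentz v w" and "k = lorentz w w"
  have k: "k < 0"
    using lorentz_orthogonal_spacelike[OF q w False] by (simp add: k_def)
  define z where "z = k *\<^sub>R v - h *\<^sub>R w"
  have "lorentz z q = 0" by (simp add: z_def lorentz_linear v w)
  then have "lorentz z z \<le> 0"
    using lorentz_orthogonal_spacelike[OF q, of z] by (cases "z = 0") (auto simp: lorentz_def)
  moreover have "lorentz z z = k * (g * k - h\<^sup>2)"
    by (simp add: z_def lorentz_linear g_def h_def k_def lorentz_commute[of w v]
        power2_eq_square algebra_simps)
  ultimately have "0 \<le> g * k - h\<^sup>2"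
    using k by (simp add: mult_le_0_iff)
  then show ?thesis by (simp add: g_def h_def k_def)
qed

lemma lorentz_ge_1:
  assumes p: "lorentz p p = 1" "snd p > 0" and q: "lorentz q q = 1" "snd q > 0"
  shows "1 \<le> lorentz p q" "lorentz p q = 1 \<longleftrightarrow> p = q"
proof -
  define a where "a = lorentz p q"
  define z where "z = p - a *\<^sub>R q"
  have zq: "lorentz z q = 0" by (simp add: z_def lorentz_linear q a_def)
  have zz: "lorentz z z = 1 - a\<^sup>2"
    by (simp add: z_def lorentz_linear p q lorentz_commute[of q p] power2_eq_square flip: a_def)
  have "lorentz z z \<le> 0"
    using lorentz_orthogonal_spacelike[OF q(1) zq] by (cases "z = 0") (auto simp: lorentz_def)
  then have a2: "1 \<le> a\<^sup>2" using zz by simp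
  have "norm (fst p) < snd p" "norm (fst q) < snd q"
    using p q by (auto intro!: power2_less_imp_less[of "norm _"]
        simp: lorentz_def power2_norm_eq_inner) (simp_all add: power2_eq_square)
  then have "norm (fst p) * norm (fst q) < snd p * snd q"
    by (intro mult_strict_mono') auto
  then have "0 < a"
    using norm_cauchy_schwarz[of "fst p" "fst q"] by (simp add: a_def lorentz_def)
  with a2 show "1 \<le> lorentz p q"
    unfolding a_def[symmetric] by (simp add: power2_nonneg_ge_1_iff)
  show "lorentz p q = 1 \<longleftrightarrow> p = q"
  proof
    assume "lorentz p q = 1"
    then have "a = 1" by (simp add: a_def)
    then have "z = 0"
      using lorentz_orthogonal_spacelike[OF q(1) zq] zz by fastforce
    then show "p = q" by (simp add: z_def \<open>a = 1\<close>)
  qed (use q in simp)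
qed

lemma arcosh_lorentz_triangle:
  assumes p: "lorentz p p = 1" "snd p > 0" and q: "lorentz q q = 1" "snd q > 0"
    and r: "lorentz r r = 1" "snd r > 0"
  shows "arcosh (lorentz p r) \<le> arcosh (lorentz p q) + arcosh (lorentz q r)"
proof -
  define a b where "a = lorentz p q" and "b = lorentz q r"
  have ab: "1 \<le> a" "1 \<le> b" and c: "1 \<le> lorentz p r"
    using lorentz_ge_1 p q r by (auto simp: a_def b_def)
  define v w where "v = p - a *\<^sub>R q" and "w = r - b *\<^sub>R q"
  have vw: "lorentz v q = 0" "lorentz w q = 0"
    by (simp_all add: v_def w_def lorentz_linear q a_def b_def lorentz_commute[of r q])
  have vv: "lorentz v v = 1 - a\<^sup>2" and ww: "lorentz w w = 1 - b\<^sup>2" and h: "lorentz v w = lorentz p r - a * b"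
    by (simp_all add: v_def w_def lorentz_linear p q r lorentz_commute[of q p]
        lorentz_commute[of r q] power2_eq_square flip: a_def b_def)
  have "(lorentz p r - a * b)\<^sup>2 \<le> (1 - a\<^sup>2) * (1 - b\<^sup>2)"
    using lorentz_Cauchy_Schwarz[OF q(1) vw] unfolding vv ww h .
  also have "\<dots> = (a\<^sup>2 - 1) * (b\<^sup>2 - 1)"
    by (simp add: algebra_simps)
  finally have "(lorentz p r - a * b)\<^sup>2 \<le> (a\<^sup>2 - 1) * (b\<^sup>2 - 1)" .
  then have "lorentz p r - a * b \<le> sqrt (a\<^sup>2 - 1) * sqrt (b\<^sup>2 - 1)"
    by (simp add: real_le_rsqrt flip: real_sqrt_mult)
  then have "lorentz p r \<le> cosh (arcosh a + arcosh b)"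
    using ab by (simp add: cosh_add sinh_arcosh_real)
  then have "cosh (arcosh (lorentz p r)) \<le> cosh (arcosh a + arcosh b)"
    using c by simp
  then show ?thesis
    using ab c by (subst (asm) cosh_real_nonneg_le_iff) (simp_all add: a_def b_def)
qed

lemma Metric_space_model: "Metric_space (model_carrier \<kappa>) (model_dist \<kappa>)"
proof
  fix p q r
  show "0 \<le> model_dist \<kappa> p q"
    by (auto simp: model_dist_def model_carrier_def inner_unit_bounds arccos_lbound lorentz_ge_1)
  show "model_dist \<kappa> p q = model_dist \<kappa> q p"
    by (simp add: model_dist_def inner_commute dist_commute lorentz_commute)
  show "model_dist \<kappa> p q = 0 \<longleftrightarrow> p = q"
    if "p \<in> model_carrier \<kappa>" "q \<in> model_carrier \<kappa>"
    using that
    by (auto simp: model_dist_def model_carrier_def arccos_inner_eq_0 lorentz_ge_1 dot_square_norm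
        split: if_splits)
  show "model_dist \<kappa> p r \<le> model_dist \<kappa> p q + model_dist \<kappa> q r"
    if "p \<in> model_carrier \<kappa>" "q \<in> model_carrier \<kappa>" "r \<in> model_carrier \<kappa>"
    using that
    by (auto simp: model_dist_def model_carrier_def dist_triangle arccos_inner_triangle
        arcosh_lorentz_triangle divide_right_mono simp flip: add_divide_distrib split: if_splits)
qed

lemma model_surface_simps [simp]:
  "mspace (model_surface \<kappa>) = model_carrier \<kappa>"
  "mdist (model_surface \<kappa>) = model_dist \<kappa>"
  by (simp_all add: model_surface_def Metric_space.mspace_metric Metric_space.mdist_metric
      Metric_space_model)

subsection \<open>Upper curvature bounds\<close>

text \<open>Under the perimeter condition the comparison points exist and are unique up to an isometry
  of the model surface, so it is immaterial which ones are taken.\<close>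

definition curvature_le :: "'a metric \<Rightarrow> real \<Rightarrow> bool" where
  "curvature_le X \<kappa> \<longleftrightarrow> complete_length_space X \<and>
     (\<forall>c s x\<^sub>1 x\<^sub>2 x\<^sub>3 y a b \<gamma>.
        c \<in> mspace X \<and> 0 < s \<and> length_convex X (mball_of X c s) \<and>
        x\<^sub>1 \<in> mball_of X c s \<and> x\<^sub>2 \<in> mball_of X c s \<and> x\<^sub>3 \<in> mball_of X c s \<and>
        (\<kappa> > 0 \<longrightarrow> mdist X x\<^sub>1 x\<^sub>2 + mdist X x\<^sub>2 x\<^sub>3 + mdist X x\<^sub>3 x\<^sub>1 < 2 * pi / sqrt \<kappa>) \<and>
        shortest_path X x\<^sub>1 x\<^sub>3 a b \<gamma> \<and> y \<in> \<gamma> ` {a..b} \<longrightarrow>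
        (\<forall>z\<^sub>1\<in>mspace (model_surface \<kappa>). \<forall>z\<^sub>2\<in>mspace (model_surface \<kappa>).
         \<forall>z\<^sub>3\<in>mspace (model_surface \<kappa>). \<forall>w a' b' \<gamma>'.
           mdist (model_surface \<kappa>) z\<^sub>1 z\<^sub>2 = mdist X x\<^sub>1 x\<^sub>2 \<and>
           mdist (model_surface \<kappa>) z\<^sub>2 z\<^sub>3 = mdist X x\<^sub>2 x\<^sub>3 \<and>
           mdist (model_surface \<kappa>) z\<^sub>1 z\<^sub>3 = mdist X x\<^sub>1 x\<^sub>3 \<and>
           shortest_path (model_surface \<kappa>) z\<^sub>1 z\<^sub>3 a' b' \<gamma>' \<and> w \<in> \<gamma>' ` {a'..b'} \<and>
           mdist (model_surface \<kappa>) z\<^sub>1 w = mdist X x\<^sub>1 y \<longrightarrow>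
           mdist X y x\<^sub>2 \<le> mdist (model_surface \<kappa>) w z\<^sub>2))"

definition Delta :: "real \<Rightarrow> 'a metric \<Rightarrow> ennreal" where
  "Delta \<kappa> X =
     (if \<kappa> > 0 then min (ennreal (pi / (4 * sqrt \<kappa>))) (convexity_radius X)
      else convexity_radius X)"

subsection \<open>Gromov--Hausdorff distance and closeness\<close>

definition correspondence :: "'a metric \<Rightarrow> 'b metric \<Rightarrow> ('a \<times> 'b) set \<Rightarrow> bool" where
  "correspondence X Y C \<longleftrightarrow>
     C \<subseteq> mspace X \<times> mspace Y \<and> fst ` C = mspace X \<and> snd ` C = mspace Y"

definition GH_dist :: "'a metric \<Rightarrow> 'b metric \<Rightarrow> ennreal" where
  "GH_dist X Y =
     (INF C\<in>{C. correspondence X Y C}.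
        SUP ((x\<^sub>1, y\<^sub>1), (x\<^sub>2, y\<^sub>2))\<in>C \<times> C. ennreal \<bar>mdist X x\<^sub>1 x\<^sub>2 - mdist Y y\<^sub>1 y\<^sub>2\<bar>) / 2"

definition GH_close :: "real \<Rightarrow> real \<Rightarrow> 'a metric \<Rightarrow> 'b metric \<Rightarrow> bool" where
  "GH_close \<epsilon> R X Y \<longleftrightarrow>
     (\<exists>C. correspondence X Y C \<and>
        (\<forall>(x\<^sub>1, y\<^sub>1)\<in>C. \<forall>(x\<^sub>2, y\<^sub>2)\<in>C.
           min (mdist X x\<^sub>1 x\<^sub>2) (mdist Y y\<^sub>1 y\<^sub>2) \<le> R \<longrightarrow>
           \<bar>mdist X x\<^sub>1 x\<^sub>2 - mdist Y y\<^sub>1 y\<^sub>2\<bar> \<le> 2 * \<epsilon>))"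

end

theory Submission
  imports Defs
begin

text \<open>As \<open>\<beta>\<close> is less than both convexity radii, geodesics between points at distance less than \<open>\<beta>\<close>
  are unique and, by compactness, depend continuously on their end points; hence a self-map that
  moves every point by less than \<open>\<beta>\<close> is homotopic to the identity along geodesics.  A map
  \<open>X \<rightarrow> X'\<close> is obtained from the correspondence by choosing partners of the points of a fine finite
  net and interpolating between them along geodesics.  Convexity of balls keeps the interpolated
  values in every ball of radius at most \<open>\<beta>\<close> that contains the partners involved, so the two maps
  obtained from the correspondence and its converse compose to self-maps moving points by less
  than \<open>\<beta>\<close>.\<close>

section \<open>Shortest paths parametrized by arc length\<close>

section \<open>Geodesics\<close>

lemma mdist_self [simp]: "x \<in> mspace X \<Longrightarrow> mdist X x x = 0"
  by simp

text \<open>Parametrized by the distance from its start, a shortest path is an isometric embedding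
  of an interval. In this form lengths disappear and only equations between distances
  remain.\<close>

definition unit_speed :: "'a metric \<Rightarrow> 'a \<Rightarrow> 'a \<Rightarrow> (real \<Rightarrow> 'a) \<Rightarrow> bool" where
  "unit_speed X x z \<sigma> \<longleftrightarrow> \<sigma> 0 = x \<and> \<sigma> (mdist X x z) = z \<and> \<sigma> \<in> {0..mdist X x z} \<rightarrow> mspace X \<and>
     (\<forall>u\<in>{0..mdist X x z}. \<forall>v\<in>{0..mdist X x z}. mdist X (\<sigma> u) (\<sigma> v) = \<bar>u - v\<bar>)"

lemma shortest_path_in_mspace:
  assumes "shortest_path X x z a b \<gamma>" "s \<in> {a..b}"
  shows "\<gamma> s \<in> mspace X"
  using assms unfolding shortest_path_def joins_def continuous_map_def by (auto simp: Pi_iff)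

text \<open>The partition \<open>a, s, t, b\<close> bounds the length from below, and the length of
  a shortest path is the distance of its ends.\<close>

lemma shortest_path_three_segments:
  assumes sp: "shortest_path X x z a b \<gamma>" and "a \<le> s" "s \<le> t" "t \<le> b"
  shows "mdist X x (\<gamma> s) + mdist X (\<gamma> s) (\<gamma> t) + mdist X (\<gamma> t) z \<le> mdist X x z"
proof -
  define p where "p = (\<lambda>i. [a, s, t, b] ! i)"
  have "ennreal (\<Sum>i<3. mdist X (\<gamma> (p i)) (\<gamma> (p (Suc i)))) \<le> curve_length X a b \<gamma>"
    unfolding curve_length_def
    by (rule Sup_upper)
       (use assms in \<open>auto simp: p_def less_Suc_eq numeral_3_eq_3 intro!: exI[of _ "3::nat"] exI[of _ p]\<close>)
  also have "\<dots> = ennreal (mdist X x z)"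
    using sp by (simp add: shortest_path_def)
  finally have "(\<Sum>i<3. mdist X (\<gamma> (p i)) (\<gamma> (p (Suc i)))) \<le> mdist X x z"
    by simp
  then show ?thesis
    using sp by (simp add: p_def numeral_3_eq_3 shortest_path_def joins_def)
qed

lemma shortest_path_additive:
  assumes sp: "shortest_path X x z a b \<gamma>" and "s \<in> {a..b}"
  shows "mdist X x (\<gamma> s) + mdist X (\<gamma> s) z = mdist X x z"
proof -
  have "\<gamma> s \<in> mspace X" "\<gamma> a \<in> mspace X" "\<gamma> b \<in> mspace X" "\<gamma> a = x" "\<gamma> b = z"
    using assms shortest_path_in_mspace[OF sp] by (auto simp: shortest_path_def joins_def)
  then show ?thesis
    using shortest_path_three_segments[OF sp, of s s] mdist_triangle[of x X "\<gamma> s" z] assms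
    by auto
qed

lemma shortest_path_attains_distance:
  assumes sp: "shortest_path X x z a b \<gamma>" and "0 \<le> u" "u \<le> mdist X x z"
  shows "\<exists>s\<in>{a..b}. mdist X x (\<gamma> s) = u"
proof -
  have ab: "a \<le> b" "\<gamma> a = x" "\<gamma> b = z" "continuous_map (top_of_set {a..b}) (mtopology_of X) \<gamma>"
    using sp by (auto simp: shortest_path_def joins_def)
  have x: "x \<in> mspace X"
    using shortest_path_in_mspace[OF sp, of a] ab by auto
  have "continuous_on {a..b} (\<lambda>s. mdist X x (\<gamma> s))"
    using x ab(4) by (simp flip: continuous_map_iff_continuous) (intro continuous_intros, auto)
  then show ?thesis
    using IVT'[of "\<lambda>s. mdist X x (\<gamma> s)" a u b] assms ab x by auto
qed

text \<open>For each \<open>u\<close> some parameter \<open>s u\<close> at distance \<open>u\<close>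
  from \<open>x\<close> exists by the intermediate value theorem. Any choice works: the
  three-segment bound and the triangle inequality force the distance between chosen points to be
  \<open>\<bar>u - v\<bar>\<close>.\<close>

lemma shortest_path_imp_unit_speed:
  assumes sp: "shortest_path X x z a b \<gamma>"
  shows "\<exists>\<sigma>. unit_speed X x z \<sigma>"
proof -
  define D where "D = mdist X x z"
  have ends: "a \<le> b" "\<gamma> a = x" "\<gamma> b = z"
    using sp by (auto simp: shortest_path_def joins_def)
  have xz: "x \<in> mspace X" "z \<in> mspace X"
    using shortest_path_in_mspace[OF sp] ends by fastforce+
  have "\<forall>u\<in>{0..D}. \<exists>s\<in>{a..b}. mdist X x (\<gamma> s) = u"
    using shortest_path_attains_distance[OF sp] by (simp add: D_def)
  then obtain s where s: "\<And>u. u \<in> {0..D} \<Longrightarrow> s u \<in> {a..b} \<and> mdist X x (\<gamma> (s u)) = u"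
    by metis
  define \<sigma> where "\<sigma> u = \<gamma> (s u)" for u
  have M: "\<sigma> u \<in> mspace X" "mdist X x (\<sigma> u) = u" "mdist X (\<sigma> u) z = D - u" if "u \<in> {0..D}" for u
    using s[OF that] shortest_path_in_mspace[OF sp] shortest_path_additive[OF sp, of "s u"]
    by (auto simp: \<sigma>_def D_def)
  have dist: "mdist X (\<sigma> u) (\<sigma> v) = \<bar>u - v\<bar>"
    if uv: "u \<in> {0..D}" "v \<in> {0..D}" and le: "s u \<le> s v" for u v
  proof -
    have "u + mdist X (\<sigma> u) (\<sigma> v) + (D - v) \<le> D"
      using shortest_path_three_segments[OF sp, of "s u" "s v"] s uv le M(2,3)
      by (auto simp: \<sigma>_def D_def)
    moreover have "v \<le> u + mdist X (\<sigma> u) (\<sigma> v)"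
      using mdist_triangle[of x X "\<sigma> u" "\<sigma> v"] M uv xz by auto
    ultimately show ?thesis
      using mdist_nonneg[of X "\<sigma> u" "\<sigma> v"] by linarith
  qed
  have "mdist X (\<sigma> u) (\<sigma> v) = \<bar>u - v\<bar>" if "u \<in> {0..D}" "v \<in> {0..D}" for u v
    using dist[OF that] dist[OF that(2,1)] mdist_commute[of X "\<sigma> u"] by (cases "s u \<le> s v") auto
  moreover have "D \<ge> 0"
    by (simp add: D_def)
  moreover have "\<sigma> 0 = x" "\<sigma> D = z"
    using M[of 0] M[of D] xz \<open>D \<ge> 0\<close> by auto
  ultimately have "unit_speed X x z \<sigma>"
    using M by (auto simp: unit_speed_def simp flip: D_def)
  then show ?thesis by blast
qed

text \<open>Along an isometric embedding every partition sum telescopes to \<open>D\<close>, hence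
  so does the supremum. Continuity holds because the map is 1-Lipschitz.\<close>

lemma unit_speed_imp_shortest_path:
  assumes \<sigma>: "unit_speed X x z \<sigma>"
  shows "shortest_path X x z 0 (mdist X x z) \<sigma>"
proof -
  define D where "D = mdist X x z"
  have D: "0 \<le> D" by (simp add: D_def)
  have M: "\<sigma> \<in> {0..D} \<rightarrow> mspace X"
    and dist: "\<And>u v. u \<in> {0..D} \<Longrightarrow> v \<in> {0..D} \<Longrightarrow> mdist X (\<sigma> u) (\<sigma> v) = \<bar>u - v\<bar>"
    using \<sigma> by (auto simp: unit_speed_def D_def)
  have "continuous_map (mtopology_of (submetric euclidean_metric {0..D})) (mtopology_of X) \<sigma>"
    using M dist
    by (intro Lipschitz_continuous_imp_continuous_map)
       (auto simp: Lipschitz_continuous_map_def Pi_iff dist_real_def intro!: exI[of _ 1])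
  then have "joins X x z 0 D \<sigma>"
    using \<sigma> D by (simp add: joins_def mtopology_of_submetric unit_speed_def D_def)
  moreover have sum: "(\<Sum>i<n. mdist X (\<sigma> (t i)) (\<sigma> (t (Suc i)))) = D"
    if t: "t 0 = 0" "t n = D" "\<forall>i<n. t i \<le> t (Suc i)" for n and t :: "nat \<Rightarrow> real"
  proof -
    \<comment> \<open>Monotonicity across the whole partition keeps its points in
      \<open>{0..D}\<close>, the range where distances along \<sigma> are known.\<close>
    have mono: "t i \<le> t j" if "i \<le> j" "j \<le> n" for i j
      using that by (induction j rule: dec_induct) (use t(3) in \<open>auto intro: order_trans\<close>)
    have "(\<Sum>i<n. mdist X (\<sigma> (t i)) (\<sigma> (t (Suc i)))) = (\<Sum>i<n. t (Suc i) - t i)"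
    proof (rule sum.cong)
      fix i assume "i \<in> {..<n}"
      then have "0 \<le> t i" "t i \<le> t (Suc i)" "t (Suc i) \<le> D"
        using mono[of 0 i] mono[of "Suc i" n] t by auto
      then show "mdist X (\<sigma> (t i)) (\<sigma> (t (Suc i))) = t (Suc i) - t i"
        by (subst dist) auto
    qed simp
    also have "\<dots> = D"
      using t by (simp add: sum_lessThan_telescope)
    finally show ?thesis .
  qed
  have "curve_length X 0 D \<sigma> = Sup {ennreal D}"
    unfolding curve_length_def
  proof (intro arg_cong[of _ _ Sup] set_eqI iffI)
    \<comment> \<open>The set of sums is nonempty: the partition \<open>0, D\<close> into a single
      interval attains \<open>D\<close>.\<close>
    fix l assume "l \<in> {ennreal D}"
    then show "l \<in> {ennreal (\<Sum>i<n. mdist X (\<sigma> (t i)) (\<sigma> (t (Suc i)))) |n t.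
        t 0 = 0 \<and> t n = D \<and> (\<forall>i<n. t i \<le> t (Suc i))}"
      using sum[of "\<lambda>i. real i * D" 1] D
      by (auto intro!: exI[of _ 1] exI[of _ "\<lambda>i. real i * D"])
  qed (use sum in auto)
  ultimately show ?thesis
    by (simp add: shortest_path_def D_def)
qed

text \<open>As the distances add up, there is no shortcut between the two pieces: a path through
  \<open>y\<close> bounds the mixed distances from above, and a shorter connection would bring
  \<open>x\<close> and \<open>z\<close> closer together than \<open>d + e\<close>.\<close>

lemma unit_speed_concat:
  assumes \<sigma>: "unit_speed X x y \<sigma>" and \<tau>: "unit_speed X y z \<tau>"
    and D: "mdist X x y + mdist X y z = mdist X x z"
  shows "unit_speed X x z (\<lambda>u. if u \<le> mdist X x y then \<sigma> u else \<tau> (u - mdist X x y))"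
proof -
  define d e where "d = mdist X x y" and "e = mdist X y z"
  have [simp]: "0 \<le> d" "0 \<le> e" and D': "mdist X x z = d + e"
    using D by (auto simp: d_def e_def)
  have S: "\<sigma> 0 = x" "\<sigma> d = y" "\<And>u. 0 \<le> u \<Longrightarrow> u \<le> d \<Longrightarrow> \<sigma> u \<in> mspace X"
    "\<And>u v. 0 \<le> u \<Longrightarrow> u \<le> d \<Longrightarrow> 0 \<le> v \<Longrightarrow> v \<le> d \<Longrightarrow> mdist X (\<sigma> u) (\<sigma> v) = \<bar>u - v\<bar>"
    using \<sigma> by (auto simp: unit_speed_def d_def Pi_iff)
  have T: "\<tau> 0 = y" "\<tau> e = z" "\<And>u. 0 \<le> u \<Longrightarrow> u \<le> e \<Longrightarrow> \<tau> u \<in> mspace X"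
    "\<And>u v. 0 \<le> u \<Longrightarrow> u \<le> e \<Longrightarrow> 0 \<le> v \<Longrightarrow> v \<le> e \<Longrightarrow> mdist X (\<tau> u) (\<tau> v) = \<bar>u - v\<bar>"
    using \<tau> by (auto simp: unit_speed_def e_def Pi_iff)
  have xyz: "x \<in> mspace X" "y \<in> mspace X" "z \<in> mspace X"
    using S(1,2) S(3)[of 0] S(3)[of d] T(2) T(3)[of e] by auto
  have mixed: "mdist X (\<sigma> u) (\<tau> v) = d - u + v" if "0 \<le> u" "u \<le> d" "0 \<le> v" "v \<le> e" for u v
  proof -
    have M: "\<sigma> u \<in> mspace X" "\<tau> v \<in> mspace X"
      using that S T by auto
    have "mdist X x (\<sigma> u) = u" "mdist X (\<sigma> u) y = d - u" "mdist X y (\<tau> v) = v" "mdist X (\<tau> v) z = e - v"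
      using that S(4)[of 0 u] S(4)[of u d] T(4)[of 0 v] T(4)[of v e] S(1,2) T(1,2) by auto
    then show ?thesis
      using mdist_triangle[of "\<sigma> u" X y "\<tau> v"] mdist_triangle[of x X "\<sigma> u" z]
        mdist_triangle[of "\<sigma> u" X "\<tau> v" z] M xyz D' by auto
  qed
  \<comment> \<open>If \<open>e = 0\<close>, the end point \<open>d + e\<close> still belongs to the
    \<sigma> branch; then \<open>y = z\<close> and the value is right.\<close>
  have "\<sigma> (d + e) = z" if "e \<le> 0"
    using that \<open>0 \<le> e\<close> S(2) T(1,2) by simp
  then show ?thesis
    using S T mixed mdist_commute[where x="\<tau> _" and y="\<sigma> _"]
    unfolding unit_speed_def D' d_def[symmetric] by auto
qed

lemma complete_length_space_unit_speed:
  assumes "complete_length_space X" "x \<in> mspace X" "z \<in> mspace X"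
  obtains \<sigma> where "unit_speed X x z \<sigma>"
  using assms shortest_path_imp_unit_speed unfolding complete_length_space_def by meson

section \<open>Dividing a geodesic in a given ratio\<close>

section \<open>Division points\<close>

text \<open>Expressed by distances alone, without paths, so that the condition is closed in all its
  arguments.\<close>

definition division_point :: "'a metric \<Rightarrow> 'a \<Rightarrow> 'a \<Rightarrow> real \<Rightarrow> 'a \<Rightarrow> bool" where
  "division_point X x z t y \<longleftrightarrow> y \<in> mspace X \<and>
     mdist X x y = t * mdist X x z \<and> mdist X y z = (1 - t) * mdist X x z"

text \<open>An arbitrary choice where several division points exist. In a complete length space it
  is determined when both ends lie in a common convex set.\<close>

definition divide_segment :: "'a metric \<Rightarrow> 'a \<Rightarrow> 'a \<Rightarrow> real \<Rightarrow> 'a" where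
  "divide_segment X x z t = (SOME y. division_point X x z t y)"

text \<open>The two defining equations add up to the full distance, so geodesics from
  \<open>x\<close> to \<open>y\<close> and from \<open>y\<close> to \<open>z\<close> concatenate to
  one through \<open>y\<close>.\<close>

lemma division_point_on_trace:
  assumes X: "complete_length_space X" and "x \<in> mspace X" "z \<in> mspace X"
    and y: "division_point X x z t y"
  obtains \<sigma> where "unit_speed X x z \<sigma>" "y \<in> \<sigma> ` {0..mdist X x z}"
proof -
  have "y \<in> mspace X" and D: "mdist X x y + mdist X y z = mdist X x z"
    using y by (auto simp: division_point_def algebra_simps)
  then obtain \<sigma> \<tau> where \<sigma>: "unit_speed X x y \<sigma>" and \<tau>: "unit_speed X y z \<tau>"
    using assms complete_length_space_unit_speed by metis
  let ?\<rho> = "\<lambda>u. if u \<le> mdist X x y then \<sigma> u else \<tau> (u - mdist X x y)"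
  have "mdist X x y \<le> mdist X x z"
    using D mdist_nonneg[of X y z] by linarith
  moreover have "y = ?\<rho> (mdist X x y)"
    using \<sigma> by (simp add: unit_speed_def)
  ultimately have "y \<in> ?\<rho> ` {0..mdist X x z}"
    by (intro image_eqI[of _ _ "mdist X x y"]) auto
  then show ?thesis
    using that unit_speed_concat[OF \<sigma> \<tau> D] by blast
qed

text \<open>All geodesics from \<open>x\<close> to \<open>z\<close> share one trace
  \<open>C\<close>, contained in \<open>A\<close>. A division point lies on some geodesic, hence on
  \<open>C\<close>, and its distance \<open>t * D\<close> from \<open>x\<close> fixes its position
  there.\<close>

lemma
  assumes X: "complete_length_space X" and A: "length_convex X A" and xz: "x \<in> A" "z \<in> A"
  shows division_point_in_convex: "division_point X x z t y \<Longrightarrow> y \<in> A"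
    and division_point_unique:
      "division_point X x z t y \<Longrightarrow> division_point X x z t y' \<Longrightarrow> y = y'"
proof -
  define D where "D = mdist X x z"
  obtain C where C: "shortest_traces X x z = {C}" "C \<subseteq> A"
    using A xz unfolding length_convex_def by blast
  have M: "x \<in> mspace X" "z \<in> mspace X"
    using A xz by (auto simp: length_convex_def)
  have trace: "\<sigma> ` {0..D} = C" if "unit_speed X x z \<sigma>" for \<sigma>
  proof -
    have "\<sigma> ` {0..D} \<in> shortest_traces X x z"
      using unit_speed_imp_shortest_path[OF that] unfolding shortest_traces_def D_def by blast
    then show ?thesis using C(1) by simp
  qed
  obtain \<sigma> where \<sigma>: "unit_speed X x z \<sigma>"
    using complete_length_space_unit_speed[OF X M] .
  have dp: "y \<in> C \<and> y = \<sigma> (t * D)" if y: "division_point X x z t y" for y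
  proof -
    have "y \<in> C"
      using division_point_on_trace[OF X M y] trace by (metis D_def)
    then obtain u where u: "u \<in> {0..D}" "y = \<sigma> u"
      using trace[OF \<sigma>] by auto
    have "mdist X x (\<sigma> u) = u"
      using \<sigma> u unfolding unit_speed_def D_def[symmetric] by force
    then show ?thesis
      using y u \<open>y \<in> C\<close> by (auto simp: division_point_def D_def)
  qed
  show "division_point X x z t y \<Longrightarrow> y \<in> A"
    using dp C(2) by blast
  show "division_point X x z t y \<Longrightarrow> division_point X x z t y' \<Longrightarrow> y = y'"
    using dp by metis
qed

lemma division_point_divide_segment:
  assumes X: "complete_length_space X" and M: "x \<in> mspace X" "z \<in> mspace X" and t: "t \<in> {0..1}"
  shows "division_point X x z t (divide_segment X x z t)"
proof -
  define D where "D = mdist X x z"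
  obtain \<sigma> where \<sigma>: "unit_speed X x z \<sigma>"
    using complete_length_space_unit_speed[OF X M] .
  have "0 \<le> t * D" "t * D \<le> D"
    using t by (auto simp: D_def mult_left_le_one_le)
  then have "mdist X (\<sigma> 0) (\<sigma> (t * D)) = t * D" "mdist X (\<sigma> (t * D)) (\<sigma> D) = D - t * D"
    "\<sigma> (t * D) \<in> mspace X"
    using \<sigma> unfolding unit_speed_def D_def[symmetric] by (auto simp: Pi_iff)
  then have "division_point X x z t (\<sigma> (t * D))"
    using \<sigma> by (simp add: division_point_def unit_speed_def D_def algebra_simps)
  then show ?thesis
    unfolding divide_segment_def by (rule someI)
qed

lemma division_point_0:
  assumes "x \<in> mspace X" shows "division_point X x z 0 y \<longleftrightarrow> y = x"
  using assms by (auto simp: division_point_def)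

lemma division_point_1:
  assumes "z \<in> mspace X" shows "division_point X x z 1 y \<longleftrightarrow> y = z"
  using assms by (auto simp: division_point_def)

section \<open>Geodesic interpolation at small scale\<close>

section \<open>Spaces with convex small balls\<close>

locale small_convex_balls =
  fixes X :: "'a metric" and \<beta> :: real
  assumes compact: "compact_space (mtopology_of X)"
    and complete_length: "complete_length_space X"
    and pos: "0 < \<beta>"
    and convex_balls: "\<lbrakk>c \<in> mspace X; 0 < s; s \<le> \<beta>\<rbrakk> \<Longrightarrow> length_convex X (mball_of X c s)"
begin

lemma divide_segment_in_ball:
  assumes "c \<in> mspace X" "0 < s" "s \<le> \<beta>" "x \<in> mball_of X c s" "z \<in> mball_of X c s" "t \<in> {0..1}"
  shows "divide_segment X x z t \<in> mball_of X c s"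
  by (rule division_point_in_convex[OF complete_length convex_balls[OF assms(1-3)] assms(4,5)],
      rule division_point_divide_segment[OF complete_length])
     (use assms in auto)

text \<open>Ends at distance less than \<beta> both lie in the convex ball of radius \<beta> about
  \<open>x\<close>. For \<open>t = 0\<close> and \<open>t = 1\<close> the equations force an end
  point at any distance, which is what blending needs where a weight vanishes.\<close>

lemma divide_segment_eqI:
  assumes M: "x \<in> mspace X" "z \<in> mspace X" and t: "t \<in> {0..1}"
    and cases: "t = 0 \<or> t = 1 \<or> mdist X x z < \<beta>"
    and y: "division_point X x z t y"
  shows "divide_segment X x z t = y"
proof -
  note div = division_point_divide_segment[OF complete_length M t]
  consider "t = 0" | "t = 1" | "mdist X x z < \<beta>"
    using cases by blast
  then show ?thesis
  proof cases
    case 3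
    then show ?thesis
      using division_point_unique[OF complete_length convex_balls[OF M(1) pos order_refl] _ _ div y] M pos
      by simp
  qed (use div y M in \<open>simp_all add: division_point_0 division_point_1\<close>)
qed

lemma divide_segment_0: "x \<in> mspace X \<Longrightarrow> z \<in> mspace X \<Longrightarrow> divide_segment X x z 0 = x"
  by (rule divide_segment_eqI) (auto simp: division_point_0)

lemma divide_segment_1: "x \<in> mspace X \<Longrightarrow> z \<in> mspace X \<Longrightarrow> divide_segment X x z 1 = z"
  by (rule divide_segment_eqI) (auto simp: division_point_1)

text \<open>Uniqueness makes the graph of the map equal to the closed set of all division points, and a
  map into a compact space with closed graph is continuous.\<close>

lemma continuous_map_divide_segment:
  assumes a: "continuous_map T (mtopology_of X) a" and b: "continuous_map T (mtopology_of X) b"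
    and \<tau>: "continuous_map T euclideanreal \<tau>"
    and t: "\<And>w. w \<in> topspace T \<Longrightarrow> \<tau> w \<in> {0..1}"
    and cases: "\<And>w. w \<in> topspace T \<Longrightarrow> \<tau> w = 0 \<or> \<tau> w = 1 \<or> mdist X (a w) (b w) < \<beta>"
  shows "continuous_map T (mtopology_of X) (\<lambda>w. divide_segment X (a w) (b w) (\<tau> w))"
proof -
  let ?P = "prod_topology T (mtopology_of X)"
  define S where "S = {p \<in> topspace ?P. division_point X (a (fst p)) (b (fst p)) (\<tau> (fst p)) (snd p)}"
  have M: "a w \<in> mspace X" "b w \<in> mspace X" if "w \<in> topspace T" for w
    using a b that by (auto simp: continuous_map_def)
  have div: "division_point X (a w) (b w) (\<tau> w) (divide_segment X (a w) (b w) (\<tau> w))"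
    if "w \<in> topspace T" for w
    using division_point_divide_segment[OF complete_length] M t that by blast
  have eq: "divide_segment X (a w) (b w) (\<tau> w) = y"
    if "w \<in> topspace T" "division_point X (a w) (b w) (\<tau> w) y" for w y
    using divide_segment_eqI M t cases that by blast
  note af = continuous_map_compose[OF continuous_map_fst a, unfolded o_def]
    and bf = continuous_map_compose[OF continuous_map_fst b, unfolded o_def]
    and \<tau>f = continuous_map_compose[OF continuous_map_fst \<tau>, unfolded o_def]
  have "S = {p \<in> topspace ?P. mdist X (a (fst p)) (snd p) = \<tau> (fst p) * mdist X (a (fst p)) (b (fst p))} \<inter>
      {p \<in> topspace ?P. mdist X (snd p) (b (fst p)) = (1 - \<tau> (fst p)) * mdist X (a (fst p)) (b (fst p))}"
    by (auto simp: S_def division_point_def)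
  \<comment> \<open>Each of the two equations compares continuous real functions on the
    product.\<close>
  also have "closedin ?P \<dots>"
    by (intro closedin_Int closedin_continuous_maps_eq[where Y=euclideanreal] continuous_intros
        continuous_map_snd af bf \<tau>f) auto
  finally have S: "closedin ?P S" .
  show ?thesis
    unfolding continuous_map_closedin
  proof (intro conjI allI impI)
    show "(\<lambda>w. divide_segment X (a w) (b w) (\<tau> w)) \<in> topspace T \<rightarrow> topspace (mtopology_of X)"
      using div by (auto simp: division_point_def)
    fix C assume C: "closedin (mtopology_of X) C"
    have "closedin ?P (S \<inter> topspace T \<times> C)"
      using S C by (intro closedin_Int) (auto simp: closedin_prod_Times_iff)
    \<comment> \<open>Projection along a compact factor is a closed map; here compactness of
      \<open>X\<close> yields continuity.\<close>
    then have "closedin T (fst ` (S \<inter> topspace T \<times> C))"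
      using closed_map_fst[OF compact, of T] by (auto simp: closed_map_def)
    moreover have "{w \<in> topspace T. divide_segment X (a w) (b w) (\<tau> w) \<in> C} = fst ` (S \<inter> topspace T \<times> C)"
    proof (intro set_eqI iffI)
      fix w assume w: "w \<in> {w \<in> topspace T. divide_segment X (a w) (b w) (\<tau> w) \<in> C}"
      then have "(w, divide_segment X (a w) (b w) (\<tau> w)) \<in> S \<inter> topspace T \<times> C"
        using div[of w] by (simp add: S_def division_point_def)
      then show "w \<in> fst ` (S \<inter> topspace T \<times> C)"
        by (metis fst_conv imageI)
    next
      fix w assume "w \<in> fst ` (S \<inter> topspace T \<times> C)"
      then obtain y where "(w, y) \<in> S" "w \<in> topspace T" "y \<in> C"
        by auto
      then show "w \<in> {w \<in> topspace T. divide_segment X (a w) (b w) (\<tau> w) \<in> C}"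
        using eq[of w y] by (simp add: S_def)
    qed
    ultimately show "closedin T {w \<in> topspace T. divide_segment X (a w) (b w) (\<tau> w) \<in> C}"
      by simp
  qed
qed

text \<open>The homotopy slides \<open>f x\<close> to \<open>x\<close>, with the division ratio as
  time; joint continuity in time and point comes from the continuity of division points.\<close>

lemma homotopic_with_id_if_close:
  assumes f: "continuous_map (mtopology_of X) (mtopology_of X) f"
    and close: "\<And>x. x \<in> mspace X \<Longrightarrow> mdist X (f x) x < \<beta>"
  shows "homotopic_with (\<lambda>_. True) (mtopology_of X) (mtopology_of X) f id"
proof -
  let ?P = "prod_topology (top_of_set {0..1::real}) (mtopology_of X)"
  have M: "f x \<in> mspace X" if "x \<in> mspace X" for x
    using f that by (auto simp: continuous_map_def)
  have "continuous_map ?P euclideanreal fst"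
    using continuous_map_fst[of "top_of_set {0..1::real}" "mtopology_of X"]
    by (simp add: continuous_map_in_subtopology)
  then have "continuous_map ?P (mtopology_of X) (\<lambda>p. divide_segment X (f (snd p)) (snd p) (fst p))"
    using continuous_map_compose[OF continuous_map_snd f, unfolded o_def] close
    by (intro continuous_map_divide_segment continuous_map_snd) auto
  then show ?thesis
    using M by (subst homotopic_with)
      (auto intro!: exI[of _ "\<lambda>p. divide_segment X (f (snd p)) (snd p) (fst p)"]
        simp: divide_segment_0 divide_segment_1)
qed

text \<open>A substitute for a partition of unity: the values \<open>e i\<close> are blended one after the other along
  geodesics.  Since \<open>\<psi> i = 1\<close> on \<open>U i\<close>, the new map is constant there and the previous map need not
  be defined on \<open>U i\<close>.\<close>

lemma blended_map_exists:
  assumes "finite I"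
    and "\<And>i. i \<in> I \<Longrightarrow> openin T (U i)"
    and "\<And>i. i \<in> I \<Longrightarrow> continuous_map T euclideanreal (\<psi> i)"
    and "\<And>i w. i \<in> I \<Longrightarrow> w \<in> topspace T \<Longrightarrow> \<psi> i w \<in> {0..1}"
    and "\<And>i w. i \<in> I \<Longrightarrow> w \<in> U i \<Longrightarrow> \<psi> i w = 1"
    and "\<And>i. i \<in> I \<Longrightarrow> e i \<in> mspace X"
    and "\<And>i j w. \<lbrakk>i \<in> I; j \<in> I; w \<in> topspace T; 0 < \<psi> i w; 0 < \<psi> j w\<rbrakk> \<Longrightarrow> mdist X (e i) (e j) < \<beta>"
  shows "\<exists>f. continuous_map (subtopology T (\<Union>i\<in>I. U i)) (mtopology_of X) f \<and>
    (\<forall>w\<in>\<Union>i\<in>I. U i. \<forall>c\<in>mspace X. \<forall>s. 0 < s \<and> s \<le> \<beta> \<and>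
       (\<forall>i\<in>I. 0 < \<psi> i w \<longrightarrow> mdist X c (e i) < s) \<longrightarrow> mdist X c (f w) < s)"
  using assms
proof (induction I rule: finite_induct)
  case empty
  then show ?case by (simp add: continuous_map_on_empty)
next
  case (insert k I)
  define D where "D = (\<Union>i\<in>I. U i)"
  note U = insert.prems(1) and \<psi> = insert.prems(2) and \<psi>01 = insert.prems(3) and \<psi>1 = insert.prems(4)
    and e = insert.prems(5) and close = insert.prems(6)
  obtain f where f: "continuous_map (subtopology T D) (mtopology_of X) f"
    and ball: "\<And>w c s. \<lbrakk>w \<in> D; c \<in> mspace X; 0 < s; s \<le> \<beta>;
       \<And>i. i \<in> I \<Longrightarrow> 0 < \<psi> i w \<Longrightarrow> mdist X c (e i) < s\<rbrakk> \<Longrightarrow> mdist X c (f w) < s"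
  proof -
    have "\<exists>f. continuous_map (subtopology T D) (mtopology_of X) f \<and>
      (\<forall>w\<in>D. \<forall>c\<in>mspace X. \<forall>s. 0 < s \<and> s \<le> \<beta> \<and>
         (\<forall>i\<in>I. 0 < \<psi> i w \<longrightarrow> mdist X c (e i) < s) \<longrightarrow> mdist X c (f w) < s)"
      unfolding D_def by (rule insert.IH; rule insert.prems; (assumption | simp))
    then show thesis
      using that by blast
  qed
  have D: "openin T D"
    using U by (auto simp: D_def)
  have UT: "U k \<subseteq> topspace T" "D \<subseteq> topspace T"
    using U[of k] D openin_subset by auto
  have ek: "e k \<in> mspace X"
    using e by simp
  have fM: "f w \<in> mspace X" if "w \<in> D" for w
    using f that UT by (auto simp: continuous_map_def)
  \<comment> \<open>The ball property of \<open>f\<close> is applied with centre \<open>e k\<close>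
    and radius \<beta>. This is why it is carried through the induction for arbitrary centres: it
    puts \<open>f w\<close> within reach of unique geodesics to \<open>e k\<close>.\<close>
  have near: "mdist X (e k) (f w) < \<beta>" if "w \<in> D" "0 < \<psi> k w" for w
    using that ek pos close[of k] UT by (intro ball) auto
  define h where "h w = divide_segment X (f w) (e k) (\<psi> k w)" for w
  define g where "g w = (if w \<in> U k then e k else h w)" for w
  have h_eq: "h w = e k" if "w \<in> U k" "w \<in> D" for w
    using that \<psi>1[of k w] fM ek by (simp add: h_def divide_segment_1)
  have h: "continuous_map (subtopology T D) (mtopology_of X) h"
    unfolding h_def
  proof (rule continuous_map_divide_segment[OF f])
    fix w assume "w \<in> topspace (subtopology T D)"
    then have w: "w \<in> D" "w \<in> topspace T" by auto
    show "\<psi> k w \<in> {0..1}"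
      using \<psi>01 w by auto
    then show "\<psi> k w = 0 \<or> \<psi> k w = 1 \<or> mdist X (f w) (e k) < \<beta>"
      using near[OF w(1)] mdist_commute[of X "e k"] by fastforce
  qed (use ek \<psi> in \<open>auto intro: continuous_map_from_subtopology\<close>)
  \<comment> \<open>Both pieces live on open sets, and on the overlap the weight 1 makes
    \<open>h\<close> equal to \<open>e k\<close>.\<close>
  have "continuous_map (subtopology T (U k \<union> D)) (mtopology_of X) g"
  proof (rule pasting_lemma[where I=UNIV and T="\<lambda>b. if b then U k else D"
        and f="\<lambda>b. if b then (\<lambda>w. e k) else h"])
    have "openin T (U k)"
      using U by simp
    with D show "openin (subtopology T (U k \<union> D)) (if b then U k else D)" for b
      by (simp add: openin_open_subtopology openin_Un)
    show "continuous_map (subtopology (subtopology T (U k \<union> D)) (if b then U k else D))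
        (mtopology_of X) (if b then \<lambda>w. e k else h)" for b
      using ek h by (cases b) (simp_all add: subtopology_subtopology Int_absorb1)
    show "(if b then \<lambda>w. e k else h) w = (if b' then \<lambda>w. e k else h) w"
      if "w \<in> topspace (subtopology T (U k \<union> D)) \<inter> (if b then U k else D) \<inter> (if b' then U k else D)" for b b' w
      using that h_eq[of w] by (cases b; cases b') simp_all
    show "\<exists>b. b \<in> UNIV \<and> w \<in> (if b then U k else D) \<and> g w = (if b then \<lambda>w. e k else h) w"
      if "w \<in> topspace (subtopology T (U k \<union> D))" for w
      using that by (intro exI[of _ "w \<in> U k"]) (auto simp: g_def)
  qed
  moreover have "mdist X c (g w) < s"
    if "w \<in> U k \<union> D" "c \<in> mspace X" "0 < s" "s \<le> \<beta>"
      and dist: "\<And>i. i \<in> insert k I \<Longrightarrow> 0 < \<psi> i w \<Longrightarrow> mdist X c (e i) < s" for w c s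
  proof (cases "w \<in> U k")
    case True
    then show ?thesis
      using dist[of k] \<psi>1[of k w] by (simp add: g_def)
  next
    case False
    then have w: "w \<in> D" "w \<in> topspace T"
      using that UT by auto
    have fw: "mdist X c (f w) < s"
      using w that by (intro ball) auto
    show ?thesis
    \<comment> \<open>With weight 0 the value \<open>f w\<close> is kept and \<open>e k\<close> may
      lie outside the ball; with positive weight both ends lie in it, and convexity applies.\<close>
    proof (cases "\<psi> k w = 0")
      case True
      then show ?thesis
        using fw fM[OF w(1)] ek False by (simp add: g_def h_def divide_segment_0)
    next
      case False
      then have "0 < \<psi> k w"
        using \<psi>01[of k w] w by auto
      then show ?thesis
        using divide_segment_in_ball[of c s "f w" "e k" "\<psi> k w"] fw dist[of k] that fM w ek \<psi>01[of k w] \<open>w \<notin> U k\<close>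
        by (simp add: g_def h_def)
    qed
  qed
  ultimately show ?case
    by (intro exI[of _ g]) (auto simp: D_def)
qed

end

text \<open>The strict inequality provides, for each centre, a bound \<open>r\<close> beyond
  \<beta>, so the radius \<beta> itself is included.\<close>

lemma small_convex_balls_convexity_radius:
  assumes "compact_space (mtopology_of X)" "complete_length_space X" "0 < \<beta>"
    and \<beta>: "ennreal \<beta> < convexity_radius X"
  shows "small_convex_balls X \<beta>"
proof
  fix c s assume c: "c \<in> mspace X" and s: "0 < s" "s \<le> \<beta>"
  have "ennreal \<beta> <
    (SUP r\<in>{r::real. 0 \<le> r \<and> (\<forall>s. 0 < s \<and> s < r \<longrightarrow> length_convex X (mball_of X c s))}. ennreal r)"
    using \<beta> c unfolding convexity_radius_def by (meson INF_lower less_le_trans)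
  then obtain r where r: "0 \<le> r" "\<forall>s. 0 < s \<and> s < r \<longrightarrow> length_convex X (mball_of X c s)"
    and "ennreal \<beta> < ennreal r"
    unfolding less_SUP_iff by blast
  then have "\<beta> < r"
    using assms(3) by (simp add: ennreal_less_iff)
  then show "length_convex X (mball_of X c s)"
    using r s by simp
qed (use assms in auto)

section \<open>From a correspondence to a homotopy equivalence\<close>

section \<open>Maps induced by a correspondence\<close>

lemma compact_space_finite_net:
  assumes "compact_space (mtopology_of X)" "0 < \<delta>"
  obtains K where "finite K" "K \<subseteq> mspace X" "\<And>x. x \<in> mspace X \<Longrightarrow> \<exists>p\<in>K. mdist X p x < \<delta>"
proof -
  interpret Metric_space "mspace X" "mdist X" by simp
  have "mtotally_bounded (mspace X)"
    using assms by (simp add: mtopology_of_def compact_space_eq_mcomplete_mtotally_bounded)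
  then obtain K where "finite K" "K \<subseteq> mspace X" "mspace X \<subseteq> (\<Union>x\<in>K. mball x \<delta>)"
    using assms(2) unfolding mtotally_bounded_def by meson
  moreover have "\<exists>p\<in>K. mdist X p x < \<delta>" if x: "x \<in> mspace X" for x
  proof -
    obtain p where "p \<in> K" "x \<in> mball p \<delta>"
      using subsetD[OF calculation(3) x] by blast
    then show ?thesis by auto
  qed
  ultimately show thesis
    using that by blast
qed

text \<open>The constant \<open>1/14\<close> leaves room: \<open>2 \<xi> \<beta> \<le> \<beta>/7\<close>, and nets are taken of mesh \<open>\<beta>/28\<close>.\<close>

definition close_pairs :: "real \<Rightarrow> 'a metric \<Rightarrow> 'b metric \<Rightarrow> ('a \<times> 'b) set \<Rightarrow> bool" where
  "close_pairs \<beta> X Y C \<longleftrightarrow> correspondence X Y C \<and>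
     (\<forall>(x\<^sub>1, y\<^sub>1)\<in>C. \<forall>(x\<^sub>2, y\<^sub>2)\<in>C. min (mdist X x\<^sub>1 x\<^sub>2) (mdist Y y\<^sub>1 y\<^sub>2) \<le> \<beta> \<longrightarrow>
        \<bar>mdist X x\<^sub>1 x\<^sub>2 - mdist Y y\<^sub>1 y\<^sub>2\<bar> \<le> \<beta> / 7)"

text \<open>The \<open>min\<close> makes the condition symmetric, so both maps come from one
  construction.\<close>

lemma close_pairs_converse:
  assumes "close_pairs \<beta> X Y C" shows "close_pairs \<beta> Y X (C\<inverse>)"
proof -
  have C: "correspondence X Y C"
    using assms by (simp add: close_pairs_def)
  have "fst ` (C\<inverse>) = snd ` C" "snd ` (C\<inverse>) = fst ` C"
    by force+
  with C have "correspondence Y X (C\<inverse>)"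
    unfolding correspondence_def by auto
  moreover have "\<bar>mdist Y y\<^sub>1 y\<^sub>2 - mdist X x\<^sub>1 x\<^sub>2\<bar> \<le> \<beta> / 7"
    if "(x\<^sub>1, y\<^sub>1) \<in> C" "(x\<^sub>2, y\<^sub>2) \<in> C" "min (mdist Y y\<^sub>1 y\<^sub>2) (mdist X x\<^sub>1 x\<^sub>2) \<le> \<beta>"
    for x\<^sub>1 y\<^sub>1 x\<^sub>2 y\<^sub>2
  proof -
    have "min (mdist X x\<^sub>1 x\<^sub>2) (mdist Y y\<^sub>1 y\<^sub>2) \<le> \<beta> \<longrightarrow> \<bar>mdist X x\<^sub>1 x\<^sub>2 - mdist Y y\<^sub>1 y\<^sub>2\<bar> \<le> \<beta> / 7"
      using assms that(1,2) unfolding close_pairs_def by blast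
    with that(3) show ?thesis
      by (simp add: min.commute abs_minus_commute)
  qed
  ultimately show ?thesis
    unfolding close_pairs_def by auto
qed

lemma close_pairs_bound:
  assumes "close_pairs \<beta> X Y C" "(x\<^sub>1, y\<^sub>1) \<in> C" "(x\<^sub>2, y\<^sub>2) \<in> C" "mdist X x\<^sub>1 x\<^sub>2 \<le> \<beta>"
  shows "mdist Y y\<^sub>1 y\<^sub>2 \<le> mdist X x\<^sub>1 x\<^sub>2 + \<beta> / 7"
proof -
  have "\<bar>mdist X x\<^sub>1 x\<^sub>2 - mdist Y y\<^sub>1 y\<^sub>2\<bar> \<le> \<beta> / 7"
    using assms unfolding close_pairs_def by fastforce
  then show ?thesis by linarith
qed

text \<open>Partners \<open>e p\<close> of net points are blended. The ball property is stated for
  all pairs of \<open>C\<close> near \<open>x\<close>, so that it no longer mentions the net or the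
  chosen partners; the last conclusion retains one pair near both \<open>x\<close> and
  \<open>f x\<close>.\<close>

lemma close_pairs_induced_map:
  assumes X: "compact_space (mtopology_of X)" and Y: "small_convex_balls Y \<beta>"
    and C: "close_pairs \<beta> X Y C"
  obtains f where "continuous_map (mtopology_of X) (mtopology_of Y) f"
    and "\<And>x c s. \<lbrakk>x \<in> mspace X; c \<in> mspace Y; 0 < s; s \<le> \<beta>;
        \<And>p q. (p, q) \<in> C \<Longrightarrow> mdist X p x < \<beta> / 14 \<Longrightarrow> mdist Y c q < s\<rbrakk> \<Longrightarrow> mdist Y c (f x) < s"
    and "\<And>x. x \<in> mspace X \<Longrightarrow> \<exists>(p, q)\<in>C. mdist X p x < \<beta> / 14 \<and> mdist Y q (f x) < 3 / 7 * \<beta>"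
proof -
  interpret Y: small_convex_balls Y \<beta> by fact
  define \<delta> where "\<delta> = \<beta> / 28"
  have \<delta>: "0 < \<delta>" using Y.pos by (simp add: \<delta>_def)
  obtain K where K: "finite K" "K \<subseteq> mspace X" "\<And>x. x \<in> mspace X \<Longrightarrow> \<exists>p\<in>K. mdist X p x < \<delta>"
    using compact_space_finite_net[OF X \<delta>] by blast
  have proj: "fst ` C = mspace X" "C \<subseteq> mspace X \<times> mspace Y"
    using C by (auto simp: close_pairs_def correspondence_def)
  then have "\<forall>p\<in>mspace X. \<exists>q. (p, q) \<in> C" by force
  then obtain e where e: "\<And>p. p \<in> mspace X \<Longrightarrow> (p, e p) \<in> C" by metis
  \<comment> \<open>A bump equal to 1 within \<delta> of \<open>p\<close>, falling linearly to 0 at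
    distance \<open>2 * \<delta>\<close>, which is \<open>\<beta> / 14\<close>.\<close>
  define \<psi> where "\<psi> p x = max 0 (min 1 (2 - mdist X p x / \<delta>))" for p x
  have \<psi>_pos: "0 < \<psi> p x \<longleftrightarrow> mdist X p x < \<beta> / 14" for p x
    using \<delta> by (auto simp: \<psi>_def field_simps \<delta>_def less_max_iff_disj)
  \<comment> \<open>The points are less than \<open>\<beta> / 7\<close> apart, so their partners are
    less than \<open>2 / 7 * \<beta>\<close> apart, within the stated bound.\<close>
  have near: "mdist Y (e p) (e q) < 3 / 7 * \<beta>"
    if "p \<in> K" "q \<in> K" "x \<in> mspace X" "mdist X p x < \<beta> / 14" "mdist X q x < \<beta> / 14" for p q x
  proof -
    have pq: "p \<in> mspace X" "q \<in> mspace X"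
      using that K(2) by auto
    have "mdist X p q < \<beta> / 7"
      using that mdist_triangle[of p X x q] pq mdist_commute[of X x q] by linarith
    then show ?thesis
      using close_pairs_bound[OF C e[OF pq(1)] e[OF pq(2)]] Y.pos by linarith
  qed
  have "\<exists>f. continuous_map (subtopology (mtopology_of X) (\<Union>p\<in>K. mball_of X p \<delta>)) (mtopology_of Y) f \<and>
    (\<forall>x\<in>\<Union>p\<in>K. mball_of X p \<delta>. \<forall>c\<in>mspace Y. \<forall>s. 0 < s \<and> s \<le> \<beta> \<and>
       (\<forall>p\<in>K. 0 < \<psi> p x \<longrightarrow> mdist Y c (e p) < s) \<longrightarrow> mdist Y c (f x) < s)"
  proof (rule Y.blended_map_exists)
    fix p assume p: "p \<in> K"
    then have pX: "p \<in> mspace X" using K(2) by auto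
    show "openin (mtopology_of X) (mball_of X p \<delta>)"
      by (simp add: mtopology_of_def mball_of_def Metric_space.openin_mball)
    show "continuous_map (mtopology_of X) euclideanreal (\<psi> p)"
      unfolding \<psi>_def using pX \<delta> by (intro continuous_intros) auto
    show "e p \<in> mspace Y"
      using e[OF pX] proj by auto
    show "\<psi> p x = 1" if "x \<in> mball_of X p \<delta>" for x
      using that \<delta> by (auto simp: \<psi>_def min_def)
    show "mdist Y (e p) (e q) < \<beta>"
      if "q \<in> K" "x \<in> topspace (mtopology_of X)" "0 < \<psi> p x" "0 < \<psi> q x" for q x
      using near[of p q x] p that Y.pos by (simp add: \<psi>_pos)
  qed (use K(1) in \<open>auto simp: \<psi>_def\<close>)
  moreover have "(\<Union>p\<in>K. mball_of X p \<delta>) = mspace X"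
    using K by force
  ultimately obtain f where f: "continuous_map (mtopology_of X) (mtopology_of Y) f"
    and ball: "\<And>x c s. \<lbrakk>x \<in> mspace X; c \<in> mspace Y; 0 < s; s \<le> \<beta>;
       \<And>p. p \<in> K \<Longrightarrow> mdist X p x < \<beta> / 14 \<Longrightarrow> mdist Y c (e p) < s\<rbrakk> \<Longrightarrow> mdist Y c (f x) < s"
    by (auto simp: \<psi>_pos subtopology_topspace[of "mtopology_of X", simplified])
  show thesis
  proof (rule that[OF f])
    fix x c s assume *: "x \<in> mspace X" "c \<in> mspace Y" "0 < s" "s \<le> \<beta>"
      "\<And>p q. (p, q) \<in> C \<Longrightarrow> mdist X p x < \<beta> / 14 \<Longrightarrow> mdist Y c q < s"
    show "mdist Y c (f x) < s"
      by (rule ball[OF *(1-4)]) (use K(2) e *(5) in blast)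
  next
    fix x assume x: "x \<in> mspace X"
    then obtain p where p: "p \<in> K" "mdist X p x < \<delta>"
      using K by blast
    then have pC: "(p, e p) \<in> C" and px: "mdist X p x < \<beta> / 14"
      using e K(2) \<delta> by (auto simp: \<delta>_def)
    have "e p \<in> mspace Y"
      using pC proj(2) by auto
    \<comment> \<open>The ball property with centre \<open>e p\<close>: all partners blended at
      \<open>x\<close> are close to this one.\<close>
    then have "mdist Y (e p) (f x) < 3 / 7 * \<beta>"
      by (rule ball[OF x]) (use Y.pos near[OF p(1) _ x px] in auto)
    then show "\<exists>(p, q)\<in>C. mdist X p x < \<beta> / 14 \<and> mdist Y q (f x) < 3 / 7 * \<beta>"
      using pC px by blast
  qed
qed

text \<open>With \<open>y = f x\<close>, every partner that the return map can blend at
  \<open>y\<close> lies in the ball of radius \<beta> about \<open>x\<close>; convexity of that ball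
  then confines the return value.\<close>

lemma close_pairs_round_trip:
  assumes C: "close_pairs \<beta> X Y C" and "0 < \<beta>" and x: "x \<in> mspace X" and y: "y \<in> mspace Y"
    and xy: "\<exists>(p, q)\<in>C. mdist X p x < \<beta> / 14 \<and> mdist Y q y < 3 / 7 * \<beta>"
    and p': "(p', q') \<in> C" "mdist Y q' y < \<beta> / 14"
  shows "mdist X x p' < \<beta>"
proof -
  obtain p q where pq: "(p, q) \<in> C" "mdist X p x < \<beta> / 14" "mdist Y q y < 3 / 7 * \<beta>"
    using xy by blast
  have M: "p \<in> mspace X" "p' \<in> mspace X" "q \<in> mspace Y" "q' \<in> mspace Y"
    using C pq(1) p'(1) by (auto simp: close_pairs_def correspondence_def)
  \<comment> \<open>Here 3/7 + 1/14 = 1/2, small enough for the correspondence to be applied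
    backwards. Returning to \<open>x\<close> adds 1/7 and 1/14, in total 5/7.\<close>
  have "mdist Y q q' < \<beta> / 2"
    using mdist_triangle[of q Y y q'] M y pq p' mdist_commute[of Y y q'] by auto
  then have "mdist X p p' < \<beta> / 2 + \<beta> / 7"
    using close_pairs_bound[OF close_pairs_converse[OF C], of q p q' p'] pq p' \<open>0 < \<beta>\<close> by auto
  then show ?thesis
    using mdist_triangle[of x X p p'] M x pq mdist_commute[of X x p] \<open>0 < \<beta>\<close> by auto
qed

lemma close_pairs_homotopy_equivalent:
  assumes X: "small_convex_balls X \<beta>" and Y: "small_convex_balls Y \<beta>"
    and C: "close_pairs \<beta> X Y C"
  shows "mtopology_of X homotopy_equivalent_space mtopology_of Y"
proof -
  interpret X: small_convex_balls X \<beta> by fact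
  interpret Y: small_convex_balls Y \<beta> by fact
  note C' = close_pairs_converse[OF C]
  obtain f where f: "continuous_map (mtopology_of X) (mtopology_of Y) f"
    and f_ball: "\<And>x c s. \<lbrakk>x \<in> mspace X; c \<in> mspace Y; 0 < s; s \<le> \<beta>;
        \<And>p q. (p, q) \<in> C \<Longrightarrow> mdist X p x < \<beta> / 14 \<Longrightarrow> mdist Y c q < s\<rbrakk> \<Longrightarrow> mdist Y c (f x) < s"
    and f_near: "\<And>x. x \<in> mspace X \<Longrightarrow> \<exists>(p, q)\<in>C. mdist X p x < \<beta> / 14 \<and> mdist Y q (f x) < 3 / 7 * \<beta>"
    using close_pairs_induced_map[OF X.compact Y C] by blast
  obtain g where g: "continuous_map (mtopology_of Y) (mtopology_of X) g"
    and g_ball: "\<And>x c s. \<lbrakk>x \<in> mspace Y; c \<in> mspace X; 0 < s; s \<le> \<beta>;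
        \<And>p q. (p, q) \<in> C\<inverse> \<Longrightarrow> mdist Y p x < \<beta> / 14 \<Longrightarrow> mdist X c q < s\<rbrakk> \<Longrightarrow> mdist X c (g x) < s"
    and g_near: "\<And>x. x \<in> mspace Y \<Longrightarrow> \<exists>(p, q)\<in>C\<inverse>. mdist Y p x < \<beta> / 14 \<and> mdist X q (g x) < 3 / 7 * \<beta>"
    using close_pairs_induced_map[OF Y.compact X C'] by blast
  have fM: "f x \<in> mspace Y" if "x \<in> mspace X" for x
    using f that by (auto simp: continuous_map_def)
  have gM: "g y \<in> mspace X" if "y \<in> mspace Y" for y
    using g that by (auto simp: continuous_map_def)
  \<comment> \<open>The ball property of \<open>g\<close> with centre \<open>x\<close> and radius
    \<beta>; the round trip estimate is its premise.\<close>
  have "mdist X x (g (f x)) < \<beta>" if x: "x \<in> mspace X" for x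
    using close_pairs_round_trip[OF C X.pos x fM[OF x] f_near[OF x]]
    by (intro g_ball fM[OF x] x X.pos) auto
  then have "homotopic_with (\<lambda>_. True) (mtopology_of X) (mtopology_of X) (g \<circ> f) id"
    by (intro X.homotopic_with_id_if_close continuous_map_compose[OF f g]) (simp add: mdist_commute)
  moreover have "mdist Y y (f (g y)) < \<beta>" if y: "y \<in> mspace Y" for y
    using close_pairs_round_trip[OF C' Y.pos y gM[OF y] g_near[OF y]]
    by (intro f_ball gM[OF y] y Y.pos) auto
  then have "homotopic_with (\<lambda>_. True) (mtopology_of Y) (mtopology_of Y) (f \<circ> g) id"
    by (intro Y.homotopic_with_id_if_close continuous_map_compose[OF g f]) (simp add: mdist_commute)
  ultimately show ?thesis
    using f g unfolding homotopy_equivalent_space_def by blast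
qed

text \<open>An infimum strictly below the bound is undercut by some correspondence, whose distortion
  is less than \<open>2 * \<epsilon>\<close> on all pairs, whatever \<open>R\<close> is.\<close>

lemma GH_dist_less_imp_GH_close:
  assumes "GH_dist X Y < ennreal \<epsilon>" "0 < \<epsilon>"
  shows "GH_close \<epsilon> R X Y"
proof -
  have "(INF C\<in>{C. correspondence X Y C}.
      SUP ((x\<^sub>1, y\<^sub>1), (x\<^sub>2, y\<^sub>2))\<in>C \<times> C. ennreal \<bar>mdist X x\<^sub>1 x\<^sub>2 - mdist Y y\<^sub>1 y\<^sub>2\<bar>) < ennreal \<epsilon> * 2"
    using assms(1) unfolding GH_dist_def by (simp add: divide_less_ennreal)
  also have "ennreal \<epsilon> * 2 = ennreal (2 * \<epsilon>)"
    using assms(2) by (simp add: ennreal_mult mult.commute)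
  finally obtain C where C: "correspondence X Y C" and
    sup: "(SUP ((x\<^sub>1, y\<^sub>1), (x\<^sub>2, y\<^sub>2))\<in>C \<times> C. ennreal \<bar>mdist X x\<^sub>1 x\<^sub>2 - mdist Y y\<^sub>1 y\<^sub>2\<bar>) < ennreal (2 * \<epsilon>)"
    unfolding INF_less_iff by blast
  have "\<bar>mdist X x\<^sub>1 x\<^sub>2 - mdist Y y\<^sub>1 y\<^sub>2\<bar> \<le> 2 * \<epsilon>" if "(x\<^sub>1, y\<^sub>1) \<in> C" "(x\<^sub>2, y\<^sub>2) \<in> C" for x\<^sub>1 x\<^sub>2 y\<^sub>1 y\<^sub>2
  proof -
    have "ennreal \<bar>mdist X x\<^sub>1 x\<^sub>2 - mdist Y y\<^sub>1 y\<^sub>2\<bar> \<le> ennreal (2 * \<epsilon>)"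
      using that by (intro order_trans[OF SUP_upper2 less_imp_le[OF sup], of "((x\<^sub>1, y\<^sub>1), (x\<^sub>2, y\<^sub>2))"]) auto
    then show ?thesis
      using assms(2) by simp
  qed
  then show ?thesis
    using C unfolding GH_close_def by (intro exI[of _ C]) auto
qed

theorem theorem3:
  fixes \<kappa> \<xi> \<beta> :: real and X :: "'a metric" and X' :: "'b metric"
  assumes "compact_space (mtopology_of X)" and "curvature_le X \<kappa>"
    and "compact_space (mtopology_of X')" and "curvature_le X' \<kappa>"
    and "\<xi> \<in> {0<..1/14}"
    and "0 < \<beta>"
    and "ennreal \<beta> < ennreal (1 / (1 + 2 * \<xi>)) * min (Delta \<kappa> X) (Delta \<kappa> X')"
  shows "(GH_close (\<xi> * \<beta>) \<beta> X X' \<longrightarrow>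
            mtopology_of X homotopy_equivalent_space mtopology_of X') \<and>
         (GH_dist X X' < ennreal (\<xi> * \<beta>) \<longrightarrow>
            mtopology_of X homotopy_equivalent_space mtopology_of X')"
proof -
  \<comment> \<open>A factor of at most 1 leaves \<beta> below both values of \<open>Delta\<close>,
    hence below both convexity radii.\<close>
  have "ennreal (1 / (1 + 2 * \<xi>)) \<le> ennreal 1"
    using assms(5) by (intro ennreal_leI) auto
  then have "ennreal (1 / (1 + 2 * \<xi>)) * min (Delta \<kappa> X) (Delta \<kappa> X') \<le> 1 * min (Delta \<kappa> X) (Delta \<kappa> X')"
    by (intro mult_right_mono) auto
  then have "ennreal \<beta> < Delta \<kappa> X" "ennreal \<beta> < Delta \<kappa> X'"
    using assms(7) by auto
  then have "ennreal \<beta> < convexity_radius X" "ennreal \<beta> < convexity_radius X'"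
    by (auto simp: Delta_def split: if_splits)
  then have convex: "small_convex_balls X \<beta>" "small_convex_balls X' \<beta>"
    using assms by (auto intro!: small_convex_balls_convexity_radius simp: curvature_le_def)
  \<comment> \<open>The bound \<open>\<xi> \<le> 1/14\<close> turns the allowed distortion into the
    \<open>\<beta> / 7\<close> of \<open>close_pairs\<close>.\<close>
  have "2 * (\<xi> * \<beta>) \<le> \<beta> / 7"
    using assms(5,6) by simp
  then have "mtopology_of X homotopy_equivalent_space mtopology_of X'" if "GH_close (\<xi> * \<beta>) \<beta> X X'"
  proof -
    obtain C where "correspondence X X' C" and C: "\<forall>(x\<^sub>1, y\<^sub>1)\<in>C. \<forall>(x\<^sub>2, y\<^sub>2)\<in>C.
           min (mdist X x\<^sub>1 x\<^sub>2) (mdist X' y\<^sub>1 y\<^sub>2) \<le> \<beta> \<longrightarrow>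
           \<bar>mdist X x\<^sub>1 x\<^sub>2 - mdist X' y\<^sub>1 y\<^sub>2\<bar> \<le> 2 * (\<xi> * \<beta>)"
      using \<open>GH_close (\<xi> * \<beta>) \<beta> X X'\<close> unfolding GH_close_def by blast
    then have "close_pairs \<beta> X X' C"
      using \<open>2 * (\<xi> * \<beta>) \<le> \<beta> / 7\<close> unfolding close_pairs_def by fastforce
    then show ?thesis
      by (rule close_pairs_homotopy_equivalent[OF convex])
  qed
  moreover have "GH_close (\<xi> * \<beta>) \<beta> X X'" if "GH_dist X X' < ennreal (\<xi> * \<beta>)"
    using GH_dist_less_imp_GH_close[OF that] assms(5,6) by simp
  ultimately show ?thesis
    by blast
qed

end
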